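(* Let $\gamma>1$, $\eta>0$ and $Q>1$ be fixed constants. Suppose $\alpha$ is a sequence of Verblunsky coefficients in $B_0(\gamma,\eta,Q)$ and $U$ is the associated CMV operator. Then there is a positive number $\delta$ such that $U$ has no resonances in the disk $\{z\in\mathbb{C}:|z|<1+\delta\}$.
   Context: $\mathbb{D}$ is the open unit disk in $\mathbb{C}$, $\mathbb{N}=\{1,2,\dots\}$, $\mathbb{N}_0=\{0,1,2,\dots\}$. Class $B_0(\gamma,\eta,Q)$: the set of all sequences $\alpha:\mathbb{N}\to\mathbb{D}$ (Verblunsky coefficients) such that (1) $|\alpha_k|\le \eta\exp(-k^\gamma)$ for all $k\in\mathbb{N}$, and (2) $\prod_{j=1}^\infty(1-|\alpha_j|)\ge 1/Q$. CMV operator: with $\rho_k=\sqrt{1-|\alpha_k|^2}$ and $\Theta_k=\begin{pmatrix}-\alpha_k&\rho_k\\ \rho_k&\overline{\alpha_k}\end{pmatrix}$, put $W=\bigoplus_{k=1}^\infty\Theta_{2k-1}$ and $V=1\oplus\bigoplus_{k=1}^\infty\Theta_{2k}$ (where $1$ is a $1\times1$ block). The CMV operator associated with $\alpha$ is the unitary operator $U=VW$ on $\ell^2(\mathbb{N}_0)$. Jost function and resonances: let $\zeta_k=z$ for $k$ odd and $\zeta_k=1$ for $k$ even. For $\alpha$ satisfying (1) and every $z\in\mathbb{C}$, the Volterra-type equations $$F(z,k)=\begin{pmatrix}1\\0\end{pmatrix}-\sum_{n=k+1}^\infty\begin{pmatrix}0&\alpha_n\zeta_n\\ z^{n-k-1}\,\overline{\alpha_n}\,\zeta_{k+1}&0\end{pmatrix}F(z,n),\qquad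 k\in\mathbb{N}_0,$$ have a unique solution $F(z,\cdot):\mathbb{N}_0\to\mathbb{C}^2$, and the components of $F(\cdot,k)$ are entire functions of $z$. The Jost function is the entire function $\psi_0(z)=C_0\,(1,-1)F(z,0)$, i.e. $C_0$ times the difference (first component minus second component) of $F(z,0)$, where $C_0=\prod_{j=1}^\infty\rho_j^{-1}$. The resonances of $U$ are the zeros of $\psi_0$ in $\mathbb{C}$. *)

theory Defs
  imports "HOL-Analysis.Analysis"
begin

(* Sequences indexed by the positive integers are functions on nat whose value at 0 is never
   used: every definition below depends only on the values at k >= 1. *)

definition verblunsky :: "(nat \<Rightarrow> complex) \<Rightarrow> bool" where
  "verblunsky \<alpha> \<longleftrightarrow> (\<forall>k\<ge>1. \<alpha> k \<in> ball 0 1)"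

definition super_exp_decay :: "real \<Rightarrow> real \<Rightarrow> (nat \<Rightarrow> complex) \<Rightarrow> bool" where
  "super_exp_decay \<gamma> \<eta> \<alpha> \<longleftrightarrow> (\<forall>k\<ge>1. cmod (\<alpha> k) \<le> \<eta> * exp (- (real k powr \<gamma>)))"

definition B0 :: "real \<Rightarrow> real \<Rightarrow> real \<Rightarrow> (nat \<Rightarrow> complex) set" where
  "B0 \<gamma> \<eta> Q = {\<alpha>. verblunsky \<alpha> \<and> super_exp_decay \<gamma> \<eta> \<alpha> \<and>
                   (\<Prod>j. 1 - cmod (\<alpha> (Suc j))) \<ge> 1 / Q}"

definition rho :: "(nat \<Rightarrow> complex) \<Rightarrow> nat \<Rightarrow> real" where
  "rho \<alpha> k = sqrt (1 - (cmod (\<alpha> k))\<^sup>2)"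

definition Theta :: "(nat \<Rightarrow> complex) \<Rightarrow> nat \<Rightarrow> complex^2^2" where
  "Theta \<alpha> k = vector [vector [- \<alpha> k, of_real (rho \<alpha> k)],
                       vector [of_real (rho \<alpha> k), cnj (\<alpha> k)]]"

(* In both direct sums the block Theta k acts on the coordinates k - 1 and k:
   the odd k give W, the even k >= 2 (together with the 1x1 block at coordinate 0) give V. *)

definition W_op :: "(nat \<Rightarrow> complex) \<Rightarrow> (nat \<Rightarrow> complex) \<Rightarrow> nat \<Rightarrow> complex" where
  "W_op \<alpha> f n =
     (if even n then (Theta \<alpha> (n + 1) *v vector [f n, f (n + 1)]) $ 1
      else (Theta \<alpha> n *v vector [f (n - 1), f n]) $ 2)"

definition V_op :: "(nat \<Rightarrow> complex) \<Rightarrow> (nat \<Rightarrow> complex) \<Rightarrow> nat \<Rightarrow> complex" where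
  "V_op \<alpha> f n =
     (if n = 0 then f 0
      else if odd n then (Theta \<alpha> (n + 1) *v vector [f n, f (n + 1)]) $ 1
      else (Theta \<alpha> n *v vector [f (n - 1), f n]) $ 2)"

definition ell2 :: "(nat \<Rightarrow> complex) set" where
  "ell2 = {f. summable (\<lambda>n. (cmod (f n))\<^sup>2)}"

(* Restricting to ell2 makes equality of these functions the same as equality of
   operators on the space of square-summable sequences. *)

definition cmv_operator :: "(nat \<Rightarrow> complex) \<Rightarrow> (nat \<Rightarrow> complex) \<Rightarrow> nat \<Rightarrow> complex" where
  "cmv_operator \<alpha> = restrict (\<lambda>f. V_op \<alpha> (W_op \<alpha> f)) ell2"

definition zeta :: "complex \<Rightarrow> nat \<Rightarrow> complex" where
  "zeta z k = (if odd k then z else 1)"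

definition jost_kernel :: "(nat \<Rightarrow> complex) \<Rightarrow> complex \<Rightarrow> nat \<Rightarrow> nat \<Rightarrow> complex^2^2" where
  "jost_kernel \<alpha> z k n =
     vector [vector [0, \<alpha> n * zeta z n],
             vector [z ^ (n - k - 1) * cnj (\<alpha> n) * zeta z (k + 1), 0]]"

(* The summation index n > k is written n = m + k + 1. *)

definition is_jost_solution :: "(nat \<Rightarrow> complex) \<Rightarrow> complex \<Rightarrow> (nat \<Rightarrow> complex^2) \<Rightarrow> bool" where
  "is_jost_solution \<alpha> z F \<longleftrightarrow>
     (\<forall>k. summable (\<lambda>m. jost_kernel \<alpha> z k (m + k + 1) *v F (m + k + 1)) \<and>
          F k = vector [1, 0] - (\<Sum>m. jost_kernel \<alpha> z k (m + k + 1) *v F (m + k + 1)))"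

definition jost_solution :: "(nat \<Rightarrow> complex) \<Rightarrow> complex \<Rightarrow> nat \<Rightarrow> complex^2" where
  "jost_solution \<alpha> z = (THE F. is_jost_solution \<alpha> z F)"

definition jost_function :: "(nat \<Rightarrow> complex) \<Rightarrow> complex \<Rightarrow> complex" where
  "jost_function \<alpha> z =
     of_real (\<Prod>j. inverse (rho \<alpha> (Suc j))) * (jost_solution \<alpha> z 0 $ 1 - jost_solution \<alpha> z 0 $ 2)"

(* The Jost function is attached to the coefficients; as these are determined by the operator
   (lemma cmv_operator_inject), so are the resonances (lemma resonances_cmv_operator). *)

definition resonances :: "((nat \<Rightarrow> complex) \<Rightarrow> nat \<Rightarrow> complex) \<Rightarrow> complex set" where
  "resonances U =
     {z. \<exists>\<alpha>. verblunsky \<alpha> \<and> (\<exists>\<gamma>>1. \<exists>\<eta>>0. super_exp_decay \<gamma> \<eta> \<alpha>) \<and>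
             U = cmv_operator \<alpha> \<and> jost_function \<alpha> z = 0}"

lemma rho_pos:
  assumes "verblunsky \<alpha>" "k \<ge> 1"
  shows "rho \<alpha> k > 0"
proof -
  have "cmod (\<alpha> k) < 1" using assms by (simp add: verblunsky_def)
  then have "(cmod (\<alpha> k))\<^sup>2 < 1" by (simp add: power_less_one_iff)
  then show ?thesis by (simp add: rho_def)
qed

lemma unit_sequence_in_ell2: "(\<lambda>n. if n = i then 1 else 0) \<in> ell2"
proof -
  have "summable (\<lambda>n. (cmod (if n = i then 1 else 0))\<^sup>2)"
    by (rule summable_finite[of "{i}"]) auto
  then show ?thesis by (simp add: ell2_def)
qed

lemma Theta_mult:
  "(Theta \<alpha> k *v vector [a, b]) $ 1 = - \<alpha> k * a + of_real (rho \<alpha> k) * b"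
  "(Theta \<alpha> k *v vector [a, b]) $ 2 = of_real (rho \<alpha> k) * a + cnj (\<alpha> k) * b"
  by (simp_all add: Theta_def matrix_vector_mult_def sum_2)

lemma cmv_operator_unit_sequence:
  fixes \<alpha> :: "nat \<Rightarrow> complex" and m :: nat
  defines "e \<equiv> \<lambda>n. if n = 2 * m then 1 else 0"
  shows "cmv_operator \<alpha> e (2 * m + 1) = - of_real (rho \<alpha> (2 * m + 1)) * \<alpha> (2 * m + 2)"
    and "m = 0 \<Longrightarrow> cmv_operator \<alpha> e 0 = - \<alpha> 1"
    and "m > 0 \<Longrightarrow> cmv_operator \<alpha> e (2 * m - 1) = - of_real (rho \<alpha> (2 * m)) * \<alpha> (2 * m + 1)"
proof -
  have eq: "cmv_operator \<alpha> e = V_op \<alpha> (W_op \<alpha> e)"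
    unfolding cmv_operator_def e_def by (simp add: unit_sequence_in_ell2)
  have e_apply: "e n = (if n = 2 * m then 1 else 0)" for n
    by (simp add: e_def)
  show "cmv_operator \<alpha> e (2 * m + 1) = - of_real (rho \<alpha> (2 * m + 1)) * \<alpha> (2 * m + 2)"
    unfolding eq by (simp add: V_op_def W_op_def Theta_mult e_apply)
  show "cmv_operator \<alpha> e 0 = - \<alpha> 1" if "m = 0"
    using that unfolding eq by (simp add: V_op_def W_op_def Theta_mult e_apply)
  show "cmv_operator \<alpha> e (2 * m - 1) = - of_real (rho \<alpha> (2 * m)) * \<alpha> (2 * m + 1)" if pos: "m > 0"
  proof -
    obtain l where l: "m = Suc l" using pos by (cases m) simp_all
    show ?thesis unfolding eq by (simp add: V_op_def W_op_def Theta_mult e_apply l)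
  qed
qed

lemma cmv_operator_inject:
  assumes a: "verblunsky \<alpha>" and b: "verblunsky \<beta>" and eq: "cmv_operator \<alpha> = cmv_operator \<beta>"
    and k: "k \<ge> 1"
  shows "\<alpha> k = \<beta> k"
proof -
  have rho_eq: "rho \<alpha> i = rho \<beta> i" if "\<alpha> i = \<beta> i" for i
    using that by (simp add: rho_def)
  have even_step: "\<alpha> (2 * m + 2) = \<beta> (2 * m + 2)" if "\<alpha> (2 * m + 1) = \<beta> (2 * m + 1)" for m
    using cmv_operator_unit_sequence(1)[of \<alpha> m] cmv_operator_unit_sequence(1)[of \<beta> m]
      eq rho_eq[OF that] rho_pos[OF a, of "2 * m + 1"] by simp
  have "\<alpha> (2 * m + 1) = \<beta> (2 * m + 1)" for m
  proof (induction m)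
    case 0
    show ?case
      using cmv_operator_unit_sequence(2)[of 0 \<alpha>] cmv_operator_unit_sequence(2)[of 0 \<beta>] eq by simp
  next
    case (Suc m)
    have "\<alpha> (2 * Suc m) = \<beta> (2 * Suc m)"
      using even_step[OF Suc] by simp
    then show ?case
      using cmv_operator_unit_sequence(3)[of "Suc m" \<alpha>] cmv_operator_unit_sequence(3)[of "Suc m" \<beta>]
        eq rho_eq[of "2 * Suc m"] rho_pos[OF a, of "2 * Suc m"] by simp
  qed
  note odd_eq = this
  show ?thesis
  proof (cases "even k")
    case True
    then obtain j where "k = 2 * j" by (elim evenE)
    then obtain m where "k = 2 * m + 2" using k by (cases j) auto
    then show ?thesis using even_step[OF odd_eq] by simp
  next
    case False
    then obtain m where "k = 2 * m + 1" by (elim oddE)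
    then show ?thesis using odd_eq by simp
  qed
qed

lemma jost_function_cong:
  assumes "\<And>k. k \<ge> 1 \<Longrightarrow> \<alpha> k = \<beta> k"
  shows "jost_function \<alpha> z = jost_function \<beta> z"
proof -
  have "rho \<alpha> (Suc j) = rho \<beta> (Suc j)" for j
    using assms by (simp add: rho_def)
  moreover have "jost_kernel \<alpha> z k (m + k + 1) = jost_kernel \<beta> z k (m + k + 1)" for k m
    using assms[of "m + k + 1"] by (simp add: jost_kernel_def)
  ultimately show ?thesis
    by (simp add: jost_function_def jost_solution_def is_jost_solution_def)
qed

lemma resonances_cmv_operator:
  assumes "verblunsky \<alpha>" "super_exp_decay \<gamma> \<eta> \<alpha>" "\<gamma> > 1" "\<eta> > 0"
  shows "resonances (cmv_operator \<alpha>) = {z. jost_function \<alpha> z = 0}"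
proof -
  have eq: "jost_function \<beta> z = jost_function \<alpha> z"
    if "verblunsky \<beta>" "cmv_operator \<alpha> = cmv_operator \<beta>" for \<beta> z
    by (rule jost_function_cong) (rule cmv_operator_inject[OF assms(1) that, symmetric])
  show ?thesis
  proof
    show "resonances (cmv_operator \<alpha>) \<subseteq> {z. jost_function \<alpha> z = 0}"
    proof
      fix z assume "z \<in> resonances (cmv_operator \<alpha>)"
      then obtain \<beta> where "verblunsky \<beta>" "cmv_operator \<alpha> = cmv_operator \<beta>" "jost_function \<beta> z = 0"
        unfolding resonances_def by blast
      with eq[of \<beta> z] show "z \<in> {z. jost_function \<alpha> z = 0}" by (metis mem_Collect_eq)
    qed
    show "{z. jost_function \<alpha> z = 0} \<subseteq> resonances (cmv_operator \<alpha>)"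
      unfolding resonances_def using assms by blast
  qed
qed

end

theory Submission
  imports Defs "HOL-Real_Asymp.Real_Asymp"
    "HOL-Probability.Discrete_Topology"
begin

text \<open>
  Put \<open>a\<^sub>k = F(z,k)\<^sub>1\<close> and \<open>x\<^sub>k = \<zeta>\<^sub>k F(z,k)\<^sub>2\<close>, so that \<open>\<psi>\<^sub>0 = C\<^sub>0 (a\<^sub>0 - x\<^sub>0)\<close>. The Volterra equations become
  the Szego recursion \<open>a\<^sub>k = a' - \<alpha> x'\<close>, \<open>x\<^sub>k = z (x' - cnj \<alpha> a')\<close>, where \<open>a', x'\<close> and \<open>\<alpha>\<close> have index
  \<open>k + 1\<close>, and
  \<open>|a' - \<alpha> x'|\<^sup>2 - |x' - cnj \<alpha> a'|\<^sup>2 = (1 - |\<alpha>|\<^sup>2) (|a'|\<^sup>2 - |x'|\<^sup>2)\<close>.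
  For some large \<open>K\<close> the ratio \<open>|x\<^sub>K / a\<^sub>K|\<close> is bounded away from 1 uniformly in \<open>|z| \<le> 2\<close>. A step from
  \<open>k + 1\<close> to \<open>k\<close> keeps it bounded away from 1, except that the factor \<open>z\<close> costs a shrinking of the disk
  \<open>|z| < 1 + \<delta>\<close>. After the \<open>K\<close> steps down to 0 this gives \<open>|x\<^sub>0| < |a\<^sub>0|\<close> on some such disk.
\<close>

section \<open>Volterra equations in a Banach space\<close>

text \<open>The bound \<open>c n\<close> on the kernel does not depend on \<open>k\<close>. The sum
  at \<open>k\<close> is thus controlled by the tail of one convergent series, and it becomes a
  contraction for large \<open>k\<close>. Below that, the equation is explicit, because its
  right-hand side reads only indices beyond \<open>k\<close>.\<close>

locale volterra_kernel =
  fixes A :: "nat \<Rightarrow> nat \<Rightarrow> 'a::banach \<Rightarrow> 'a" and c :: "nat \<Rightarrow> real"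
  assumes linear_kernel: "linear (A k n)"
    and bound: "k < n \<Longrightarrow> norm (A k n v) \<le> c n * norm v"
    and c_nonneg: "0 \<le> c n"
    and c_summable: "summable c"
begin

definition integral_sum :: "(nat \<Rightarrow> 'a) \<Rightarrow> nat \<Rightarrow> 'a" where
  "integral_sum F k = (\<Sum>m. A k (m + k + 1) (F (m + k + 1)))"

lemma summable_c_shift: "summable (\<lambda>m. c (m + k + 1))"
  using summable_ignore_initial_segment[OF c_summable, of "k + 1"] by (simp add: add.assoc)

lemma
  assumes "\<And>n. k < n \<Longrightarrow> norm (F n) \<le> B"
  shows summable_kernel: "summable (\<lambda>m. A k (m + k + 1) (F (m + k + 1)))"
    and norm_integral_sum_le: "norm (integral_sum F k) \<le> (\<Sum>m. c (m + k + 1)) * B"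
proof -
  have le: "norm (A k (m + k + 1) (F (m + k + 1))) \<le> c (m + k + 1) * B" for m
    by (rule order_trans[OF bound mult_left_mono[OF assms c_nonneg]]) auto
  have sm: "summable (\<lambda>m. c (m + k + 1) * B)"
    by (rule summable_mult2[OF summable_c_shift])
  show "summable (\<lambda>m. A k (m + k + 1) (F (m + k + 1)))"
    by (rule summable_comparison_test'[OF sm, of 0]) (use le in auto)
  have sn: "summable (\<lambda>m. norm (A k (m + k + 1) (F (m + k + 1))))"
    by (rule summable_comparison_test'[OF sm, of 0]) (use le in auto)
  have "norm (integral_sum F k) \<le> (\<Sum>m. norm (A k (m + k + 1) (F (m + k + 1))))"
    unfolding integral_sum_def by (rule summable_norm[OF sn])
  also have "\<dots> \<le> (\<Sum>m. c (m + k + 1) * B)"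
    by (rule suminf_le[OF le sn sm])
  also have "\<dots> = (\<Sum>m. c (m + k + 1)) * B"
    by (rule suminf_mult2[OF summable_c_shift, symmetric])
  finally show "norm (integral_sum F k) \<le> (\<Sum>m. c (m + k + 1)) * B" .
qed

lemma integral_sum_diff:
  assumes "\<And>n. norm (F n) \<le> B" "\<And>n. norm (G n) \<le> C"
  shows "integral_sum F k - integral_sum G k = integral_sum (\<lambda>n. F n - G n) k"
  unfolding integral_sum_def
  by (subst suminf_diff[OF summable_kernel summable_kernel])
    (use assms in \<open>auto simp: linear_diff[OF linear_kernel]\<close>)

lemma integral_sum_cong:
  "(\<And>n. k < n \<Longrightarrow> F n = G n) \<Longrightarrow> integral_sum F k = integral_sum G k"
  unfolding integral_sum_def by (rule suminf_cong) auto

lemma tail_small: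
  assumes "e > 0"
  obtains K where "\<And>k. K \<le> k \<Longrightarrow> (\<Sum>m. c (m + k + 1)) \<le> e"
proof -
  obtain N where N: "\<And>n. N \<le> n \<Longrightarrow> norm (\<Sum>i. c (i + n)) < e"
    using suminf_exist_split[OF assms c_summable] by blast
  show ?thesis
  proof
    fix k assume "N \<le> k"
    then show "(\<Sum>m. c (m + k + 1)) \<le> e" using N[of "k + 1"] by (simp add: add.assoc)
  qed
qed

text \<open>From \<open>K\<close> on, the equation gives \<open>s \<le> norm u + e * s\<close> for
  the supremum \<open>s\<close> of the norms over these indices. The bound \<open>B\<close> only
  makes \<open>s\<close> finite, so it does not enter the estimate. The case \<open>u = 0\<close>
  yields uniqueness; the case of the Jost source yields a bound that is uniform in z.\<close>

lemma bounded_solution_near_source: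
  assumes F: "\<And>k. F k = u - integral_sum F k" and bd: "\<And>n. norm (F n) \<le> B"
    and tail: "\<And>k. K \<le> k \<Longrightarrow> (\<Sum>m. c (m + k + 1)) \<le> e" and e: "0 \<le> e" "e < 1"
    and k: "K \<le> k"
  shows "norm (F k - u) \<le> e * (norm u / (1 - e))"
proof -
  define s where "s = (SUP n\<in>{K..}. norm (F n))"
  have bdd: "bdd_above ((\<lambda>n. norm (F n)) ` {K..})" using bd by (auto intro!: bdd_aboveI2)
  have le_s: "norm (F n) \<le> s" if "K \<le> n" for n
    unfolding s_def by (rule cSUP_upper[OF _ bdd]) (use that in auto)
  have s0: "0 \<le> s" using le_s[of K] norm_ge_zero order_trans by blast
  have est: "norm (F n - u) \<le> e * s" if "K \<le> n" for n
  proof -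
    have "norm (F n - u) = norm (integral_sum F n)"
      using F[of n] by (metis add_diff_cancel_left' diff_add_cancel minus_diff_eq norm_minus_commute)
    also have "\<dots> \<le> (\<Sum>m. c (m + n + 1)) * s"
      by (rule norm_integral_sum_le) (use le_s that in auto)
    also have "\<dots> \<le> e * s" by (rule mult_right_mono[OF tail[OF that] s0])
    finally show ?thesis .
  qed
  have "s \<le> norm u + e * s"
    unfolding s_def
  proof (rule cSUP_least)
    fix n assume "n \<in> {K..}"
    then show "norm (F n) \<le> norm u + e * (SUP n\<in>{K..}. norm (F n))"
      using est[of n] norm_triangle_sub[of "F n" u] unfolding s_def by auto
  qed auto
  then have "s \<le> norm u / (1 - e)" using e by (simp add: field_simps)
  then show ?thesis using est[OF k] mult_left_mono[OF _ e(1)] order_trans by blast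
qed

text \<open>The difference of two solutions solves the equation with source 0, so the previous
  estimate makes it vanish on a tail. Every earlier value is determined by later ones.\<close>

lemma bounded_solution_unique:
  assumes F: "\<And>k. F k = u - integral_sum F k" and bF: "\<And>n. norm (F n) \<le> B"
    and G: "\<And>k. G k = u - integral_sum G k" and bG: "\<And>n. norm (G n) \<le> C"
  shows "F = G"
proof -
  define D where "D = (\<lambda>n. F n - G n)"
  have D: "D k = 0 - integral_sum D k" for k
  proof -
    have "D k = - (integral_sum F k - integral_sum G k)"
      unfolding D_def by (subst F, subst G) simp
    then show ?thesis using integral_sum_diff[OF bF bG] by (simp add: D_def)
  qed
  have bD: "norm (D n) \<le> B + C" for n
    unfolding D_def using bF[of n] bG[of n] norm_triangle_ineq4[of "F n" "G n"] by linarith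
  obtain K where K: "\<And>k. K \<le> k \<Longrightarrow> (\<Sum>m. c (m + k + 1)) \<le> 1/2"
    using tail_small[of "1/2"] by auto
  have tail0: "D k = 0" if "K \<le> k" for k
    using bounded_solution_near_source[OF D bD K, of K k] that by simp
  \<comment> \<open>Downward induction by truncated subtraction: \<open>j = K\<close> reaches the
    index 0.\<close>
  have "\<forall>k \<ge> K - j. D k = 0" for j
  proof (induction j)
    case (Suc j)
    show ?case
    proof (intro allI impI)
      fix k assume "K - Suc j \<le> k"
      then have "integral_sum D k = integral_sum (\<lambda>_. 0) k"
        by (intro integral_sum_cong) (use Suc in auto)
      then show "D k = 0" using D[of k]
        by (simp add: integral_sum_def linear_0[OF linear_kernel])
    qed
  qed (use tail0 in auto)
  from this[of K] show ?thesis by (auto simp: D_def)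
qed

text \<open>Banach's fixed point theorem in the supremum norm: where the tails of \<open>c\<close>
  are at most 1/2, the right-hand side of the equation is a contraction with factor 1/2.\<close>

lemma bounded_solution_on_tail:
  obtains K F B where "\<And>k. K \<le> k \<Longrightarrow> F k = u - integral_sum F k" "\<And>n. norm (F n) \<le> B"
proof -
  obtain K where K: "\<And>k. K \<le> k \<Longrightarrow> (\<Sum>m. c (m + k + 1)) \<le> 1/2"
    using tail_small[of "1/2"] by auto
  \<comment> \<open>The value 0 below \<open>K\<close> is harmless, as the equations from
    \<open>K\<close> on never read it.\<close>
  define T where "T g k = (if K \<le> k then u - integral_sum g k else 0)" for g k
  have int_le: "norm (integral_sum g k) \<le> 1/2 * B"
    if "\<And>n. norm (g n) \<le> B" "K \<le> k" for g B k
  proof -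
    have "0 \<le> B" using that(1)[of 0] norm_ge_zero order_trans by blast
    then show ?thesis
      using norm_integral_sum_le[of k g B] mult_right_mono[OF K[OF that(2)]] that(1) order_trans
      by blast
  qed
  \<comment> \<open>Completeness of the space of bounded continuous functions needs a metric on the domain,
    which \<open>nat\<close> lacks.\<close>
  define val :: "(nat discrete \<Rightarrow>\<^sub>C 'a) \<Rightarrow> nat \<Rightarrow> 'a" where "val g n = apply_bcontfun g (discrete n)" for g n
  have val_le: "norm (val g n) \<le> norm g" for g n
    unfolding val_def by (rule norm_bounded)
  have T_bc: "(\<lambda>d. T (val g) (of_discrete d)) \<in> bcontfun" for g
  proof (rule bcontfun_normI)
    show "norm (T (val g) (of_discrete d)) \<le> norm u + 1/2 * norm g" for d
      using int_le[of "val g" "norm g" "of_discrete d", OF val_le]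
        norm_triangle_ineq4[of u "integral_sum (val g) (of_discrete d)"]
        norm_ge_zero[of u] norm_ge_zero[of g]
      unfolding T_def by auto
    show "continuous_on UNIV (\<lambda>d. T (val g) (of_discrete d))"
      by (simp add: continuous_on_open_vimage open_discrete)
  qed
  define S where "S g = Bcontfun (\<lambda>d. T (val g) (of_discrete d))" for g
  have S: "apply_bcontfun (S g) = (\<lambda>d. T (val g) (of_discrete d))" for g
    unfolding S_def by (rule Bcontfun_inverse[OF T_bc])
  have "\<exists>!g. S g = g"
  proof (rule banach_fix_type[of "1/2"])
    show "\<forall>g h. dist (S g) (S h) \<le> 1/2 * dist g h"
    proof (intro allI dist_bound)
      fix g h and d :: "nat discrete"
      define k where "k = of_discrete d"
      show "dist (apply_bcontfun (S g) d) (apply_bcontfun (S h) d) \<le> 1/2 * dist g h"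
      proof (cases "K \<le> k")
        case True
        have "dist (apply_bcontfun (S g) d) (apply_bcontfun (S h) d)
            = norm (integral_sum (val g) k - integral_sum (val h) k)"
          using True by (simp add: S T_def dist_norm norm_minus_commute flip: k_def)
        also have "\<dots> = norm (integral_sum (\<lambda>n. val g n - val h n) k)"
          by (subst integral_sum_diff[OF val_le val_le]) (rule refl)
        also have "\<dots> \<le> 1/2 * dist g h"
          by (rule int_le[OF _ True]) (metis dist_bounded dist_norm val_def)
        finally show ?thesis .
      qed (simp add: S T_def flip: k_def)
    qed
  qed auto
  then obtain g where g: "S g = g" by blast
  show ?thesis
  proof
    show "val g k = u - integral_sum (val g) k" if "K \<le> k" for k
      using fun_cong[OF S[of g], of "discrete k"] that
      unfolding g by (simp add: T_def val_def discrete_inverse)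
    show "norm (val g n) \<le> norm g" for n by (rule val_le)
  qed
qed

text \<open>The tail solution is extended downwards one index at a time. Redefining the value at
  \<open>i\<close> changes no sum at an index \<open>k \<ge> i\<close>, so the equations already
  obtained survive, and a single new value keeps the function bounded.\<close>

lemma bounded_solution_exists:
  obtains F B where "\<And>k. F k = u - integral_sum F k" "\<And>n. norm (F n) \<le> B"
proof -
  obtain K F0 B0 where 0: "\<And>k. K \<le> k \<Longrightarrow> F0 k = u - integral_sum F0 k"
      "\<And>n. norm (F0 n) \<le> B0"
    by (rule bounded_solution_on_tail) blast
  have "\<exists>F B. (\<forall>k \<ge> K - j. F k = u - integral_sum F k) \<and> (\<forall>n. norm (F n) \<le> B)" for j
  proof (induction j)
    case (Suc j)
    then obtain F B where F: "\<And>k. K - j \<le> k \<Longrightarrow> F k = u - integral_sum F k"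
      and B: "\<And>n. norm (F n) \<le> B" by blast
    define i where "i = K - Suc j"
    define G where "G = F(i := u - integral_sum F i)"
    have eq: "integral_sum G k = integral_sum F k" if "i \<le> k" for k
      by (rule integral_sum_cong) (use that in \<open>auto simp: G_def\<close>)
    have "G k = u - integral_sum G k" if "i \<le> k" for k
      unfolding eq[OF that] using F[of k] that by (auto simp: G_def i_def)
    moreover have "norm (G n) \<le> max B (norm (u - integral_sum F i))" for n
      using B[of n] by (auto simp: G_def)
    ultimately show ?case unfolding i_def by blast
  qed (use 0 in auto)
  from this[of K] obtain F B where "\<And>k. F k = u - integral_sum F k" "\<And>n. norm (F n) \<le> B"
    by (metis diff_self_eq_0 le0)
  then show ?thesis by (rule that)
qed

end

section \<open>Existence and uniqueness of the Jost solution for |z| \<le> 2\<close>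

text \<open>The weights \<open>2 ^ (n + 1)\<close> absorb the powers of z in the kernel for |z|
  \<le> 2. As \<gamma> > 1, the decay beats every geometric growth; comparison with
  \<open>(1/2) ^ n\<close> suffices.\<close>

lemma summable_super_exp_decay:
  assumes "super_exp_decay \<gamma> \<eta> \<alpha>" "\<gamma> > 1"
  shows "summable (\<lambda>n. 2 ^ (n + 1) * cmod (\<alpha> n))"
proof (rule summable_comparison_test_bigo)
  show "summable (\<lambda>n. norm ((1/2::real) ^ n))" by simp
  have "(\<lambda>n. 2 ^ (n + 1) * cmod (\<alpha> n)) \<in> O(\<lambda>n. 2 ^ (n + 1) * (\<eta> * exp (- (real n powr \<gamma>))))"
  \<comment> \<open>The decay hypothesis says nothing about index 0, so the comparison starts at
    1.\<close>
  proof (rule landau_o.big_mono, rule eventually_mono[OF eventually_ge_at_top[of 1]])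
    fix n :: nat assume "1 \<le> n"
    then have "cmod (\<alpha> n) \<le> \<eta> * exp (- (real n powr \<gamma>))"
      using assms(1) by (simp add: super_exp_decay_def)
    also have "\<dots> \<le> \<bar>\<eta>\<bar> * exp (- (real n powr \<gamma>))" by (simp add: mult_right_mono)
    finally have "cmod (\<alpha> n) \<le> \<bar>\<eta>\<bar> * exp (- (real n powr \<gamma>))" .
    then show "norm (2 ^ (n + 1) * cmod (\<alpha> n)) \<le> norm (2 ^ (n + 1) * (\<eta> * exp (- (real n powr \<gamma>))))"
      by (simp add: abs_mult)
  qed
  also have "(\<lambda>n. 2 ^ (n + 1) * (\<eta> * exp (- (real n powr \<gamma>)))) \<in> O(\<lambda>n. exp (- (real n powr \<gamma>)) * 2 ^ n)"
    by (auto intro!: bigoI[where c = "2 * \<bar>\<eta>\<bar>"] simp: abs_mult)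
  also have "(\<lambda>n. exp (- (real n powr \<gamma>)) * 2 ^ n) \<in> O(\<lambda>n. (1/2::real) ^ n)"
    using assms(2) by real_asymp
  finally show "(\<lambda>n. 2 ^ (n + 1) * cmod (\<alpha> n)) \<in> O(\<lambda>n. (1/2) ^ n)" .
qed

lemma jost_kernel_mult:
  "(jost_kernel \<alpha> z k n *v v) $ 1 = \<alpha> n * zeta z n * v $ 2"
  "(jost_kernel \<alpha> z k n *v v) $ 2 = z ^ (n - k - 1) * cnj (\<alpha> n) * zeta z (k + 1) * v $ 1"
  by (simp_all add: jost_kernel_def matrix_vector_mult_def sum_2)

lemma norm_complex2_le: "norm (v :: complex^2) \<le> cmod (v $ 1) + cmod (v $ 2)"
  unfolding norm_vec_def using L2_set_le_sum[of UNIV "\<lambda>i. norm (v $ i)"] by (simp add: sum_2)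

text \<open>Each component costs at most a factor \<open>2 ^ n\<close>: in the first,
  \<open>zeta z n\<close> is at most 2 and n \<ge> 1; in the second, the power of z and
  \<open>zeta\<close> together give at most \<open>2 ^ (n - k)\<close>. Adding the two components
  gives \<open>2 ^ (n + 1)\<close>. The radius 2 leaves room beyond the unit circle.\<close>

lemma jost_volterra_kernel:
  assumes "summable (\<lambda>n. 2 ^ (n + 1) * cmod (\<alpha> n))" and z: "cmod z \<le> 2"
  shows "volterra_kernel (\<lambda>k n. (*v) (jost_kernel \<alpha> z k n)) (\<lambda>n. 2 ^ (n + 1) * cmod (\<alpha> n))"
proof (rule volterra_kernel.intro)
  show "linear ((*v) (jost_kernel \<alpha> z k n))" for k n
    by (rule matrix_vector_mul_linear)
  show "0 \<le> 2 ^ (n + 1) * cmod (\<alpha> n)" for n by simp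
  have zeta: "cmod (zeta z i) \<le> 2" for i using z by (simp add: zeta_def)
  show "norm (jost_kernel \<alpha> z k n *v v) \<le> 2 ^ (n + 1) * cmod (\<alpha> n) * norm v" if "k < n" for k n v
  proof -
    have "cmod (zeta z n) \<le> 2 ^ n"
      by (rule order_trans[OF zeta]) (use that in \<open>simp add: self_le_power\<close>)
    then have 1: "cmod ((jost_kernel \<alpha> z k n *v v) $ 1) \<le> cmod (\<alpha> n) * 2 ^ n * norm v"
      unfolding jost_kernel_mult norm_mult
      by (intro mult_mono) (auto simp: Finite_Cartesian_Product.norm_nth_le)
    have "cmod z ^ (n - k - 1) * cmod (zeta z (k + 1)) \<le> 2 ^ (n - k - 1) * 2"
      by (intro mult_mono power_mono z zeta) auto
    also have "\<dots> = 2 ^ Suc (n - k - 1)" by simp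
    also have "\<dots> \<le> (2 ^ n :: real)" using that by (intro power_increasing) auto
    finally have "cmod (\<alpha> n) * (cmod z ^ (n - k - 1) * cmod (zeta z (k + 1))) * cmod (v $ 1)
        \<le> cmod (\<alpha> n) * 2 ^ n * norm v"
      by (intro mult_mono) (auto simp: Finite_Cartesian_Product.norm_nth_le)
    then have 2: "cmod ((jost_kernel \<alpha> z k n *v v) $ 2) \<le> cmod (\<alpha> n) * 2 ^ n * norm v"
      unfolding jost_kernel_mult norm_mult norm_power complex_mod_cnj by (simp only: mult_ac)
    have "norm (jost_kernel \<alpha> z k n *v v) \<le> 2 * (cmod (\<alpha> n) * 2 ^ n * norm v)"
      using norm_complex2_le[of "jost_kernel \<alpha> z k n *v v"] 1 2 by linarith
    then show ?thesis by (simp add: mult_ac)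
  qed
qed (rule assms(1))

lemma jost_solution_components:
  assumes "is_jost_solution \<alpha> z F"
  shows "summable (\<lambda>m. \<alpha> (m + k + 1) * zeta z (m + k + 1) * F (m + k + 1) $ 2)"
    and "F k $ 1 = 1 - (\<Sum>m. \<alpha> (m + k + 1) * zeta z (m + k + 1) * F (m + k + 1) $ 2)"
    and "summable (\<lambda>m. z ^ m * cnj (\<alpha> (m + k + 1)) * zeta z (k + 1) * F (m + k + 1) $ 1)"
    and "F k $ 2 = - (\<Sum>m. z ^ m * cnj (\<alpha> (m + k + 1)) * zeta z (k + 1) * F (m + k + 1) $ 1)"
proof -
  define J where "J = (\<lambda>m. jost_kernel \<alpha> z k (m + k + 1) *v F (m + k + 1))"
  have s: "summable J" and F: "F k = vector [1, 0] - suminf J"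
    using assms unfolding is_jost_solution_def J_def by blast+
  have J: "J m $ 1 = \<alpha> (m + k + 1) * zeta z (m + k + 1) * F (m + k + 1) $ 2"
    "J m $ 2 = z ^ m * cnj (\<alpha> (m + k + 1)) * zeta z (k + 1) * F (m + k + 1) $ 1" for m
    unfolding J_def jost_kernel_mult by simp_all
  have c: "summable (\<lambda>m. J m $ i)" "suminf J $ i = (\<Sum>m. J m $ i)" for i
    using bounded_linear.summable[OF bounded_linear_vec_nth s]
      bounded_linear.suminf[OF bounded_linear_vec_nth s] by auto
  show "summable (\<lambda>m. \<alpha> (m + k + 1) * zeta z (m + k + 1) * F (m + k + 1) $ 2)"
    "summable (\<lambda>m. z ^ m * cnj (\<alpha> (m + k + 1)) * zeta z (k + 1) * F (m + k + 1) $ 1)"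
    using c(1)[of 1] c(1)[of 2] unfolding J .
  show "F k $ 1 = 1 - (\<Sum>m. \<alpha> (m + k + 1) * zeta z (m + k + 1) * F (m + k + 1) $ 2)"
    "F k $ 2 = - (\<Sum>m. z ^ m * cnj (\<alpha> (m + k + 1)) * zeta z (k + 1) * F (m + k + 1) $ 1)"
    unfolding F using c(2)[of 1] c(2)[of 2] unfolding J by simp_all
qed

text \<open>\<open>is_jost_solution\<close> asks only for summability, while uniqueness was shown
  among bounded functions; this closes the gap. The first row of the kernel does not depend on
  \<open>k\<close>, so the first component is 1 minus a tail of one convergent series. The second
  component is the kernel applied to the first.\<close>

lemma jost_solution_bounded:
  assumes sm: "summable (\<lambda>n. 2 ^ (n + 1) * cmod (\<alpha> n))" and z: "cmod z \<le> 2"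
    and F: "is_jost_solution \<alpha> z F"
  obtains B where "\<And>n. norm (F n) \<le> B"
proof -
  define t where "t m = \<alpha> (m + 1) * zeta z (m + 1) * F (m + 1) $ 2" for m
  have t: "summable t" using jost_solution_components(1)[OF F, of 0] by (simp add: t_def[abs_def])
  have "Bseq (\<lambda>n. \<Sum>m<n. t m)"
    using t by (simp add: summable_iff_convergent convergent_imp_Bseq)
  then obtain M where M: "\<And>n. norm (\<Sum>m<n. t m) \<le> M" by (auto simp: Bseq_def)
  define B where "B = 1 + norm (suminf t) + M"
  have F1: "cmod (F k $ 1) \<le> B" for k
  proof -
    have "F k $ 1 = 1 - (suminf t - (\<Sum>m<k. t m))"
      using jost_solution_components(2)[OF F, of k] suminf_minus_initial_segment[OF t, of k]
      by (simp add: t_def[abs_def])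
    then have "F k $ 1 = 1 - suminf t + (\<Sum>m<k. t m)" by simp
    then show ?thesis
      using norm_triangle_ineq[of "1 - suminf t" "\<Sum>m<k. t m"] norm_triangle_ineq4[of 1 "suminf t"] M[of k]
      unfolding B_def by simp
  qed
  interpret volterra_kernel "\<lambda>k n. (*v) (jost_kernel \<alpha> z k n)" "\<lambda>n. 2 ^ (n + 1) * cmod (\<alpha> n)"
    by (rule jost_volterra_kernel[OF sm z])
  \<comment> \<open>The second component of the integral sees only the first component of the solution.\<close>
  define G :: "nat \<Rightarrow> complex^2" where "G n = vector [F n $ 1, 0]" for n
  have G: "norm (G n) \<le> B" for n
    using norm_complex2_le[of "G n"] F1[of n] by (simp add: G_def)
  have B0: "0 \<le> B" using F1[of 0] norm_ge_zero order_trans by blast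
  define C where "C = (\<Sum>n. 2 ^ (n + 1) * cmod (\<alpha> n))"
  have F2: "cmod (F k $ 2) \<le> C * B" for k
  proof -
    define J where "J m = jost_kernel \<alpha> z k (m + k + 1) *v G (m + k + 1)" for m
    have s: "summable J" unfolding J_def by (rule summable_kernel[OF G])
    have "integral_sum G k $ 2 = (\<Sum>m. J m $ 2)"
      unfolding integral_sum_def J_def[symmetric]
      by (rule bounded_linear.suminf[OF bounded_linear_vec_nth s])
    then have "F k $ 2 = - integral_sum G k $ 2"
      using jost_solution_components(4)[OF F, of k] by (simp add: J_def jost_kernel_mult G_def)
    then have "cmod (F k $ 2) \<le> norm (integral_sum G k)" by (simp add: Finite_Cartesian_Product.norm_nth_le)
    also have "\<dots> \<le> (\<Sum>m. 2 ^ (m + k + 1 + 1) * cmod (\<alpha> (m + k + 1))) * B"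
      by (rule norm_integral_sum_le[OF G])
    also have "(\<Sum>m. 2 ^ (m + k + 1 + 1) * cmod (\<alpha> (m + k + 1))) \<le> C"
    proof -
      have "0 \<le> (\<Sum>n<k + 1. 2 ^ (n + 1) * cmod (\<alpha> n))" by (intro sum_nonneg) auto
      then show ?thesis
        using suminf_minus_initial_segment[OF sm, of "k + 1"]
        unfolding C_def by (simp only: add.assoc)
    qed
    finally show ?thesis using B0 by (simp add: mult_right_mono)
  qed
  show ?thesis
  proof
    show "norm (F n) \<le> B + C * B" for n
      using norm_complex2_le[of "F n"] F1[of n] F2[of n] by linarith
  qed
qed

text \<open>Justifies the definite description in \<open>jost_solution\<close>: a bounded solution
  exists, and any solution is bounded and hence equal to it.\<close>

lemma jost_solution_is_solution:
  assumes sm: "summable (\<lambda>n. 2 ^ (n + 1) * cmod (\<alpha> n))" and z: "cmod z \<le> 2"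
  shows "is_jost_solution \<alpha> z (jost_solution \<alpha> z)"
proof -
  interpret volterra_kernel "\<lambda>k n. (*v) (jost_kernel \<alpha> z k n)" "\<lambda>n. 2 ^ (n + 1) * cmod (\<alpha> n)"
    by (rule jost_volterra_kernel[OF sm z])
  obtain F B where F: "\<And>k. F k = vector [1, 0] - integral_sum F k" "\<And>n. norm (F n) \<le> B"
    by (rule bounded_solution_exists) blast
  have "is_jost_solution \<alpha> z F"
    unfolding is_jost_solution_def
  proof (intro allI conjI)
    show "summable (\<lambda>m. jost_kernel \<alpha> z k (m + k + 1) *v F (m + k + 1))" for k
      by (rule summable_kernel[OF F(2)])
    show "F k = vector [1, 0] - (\<Sum>m. jost_kernel \<alpha> z k (m + k + 1) *v F (m + k + 1))" for k
      using F(1)[of k] unfolding integral_sum_def .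
  qed
  moreover have "G = F" if G: "is_jost_solution \<alpha> z G" for G
  proof -
    obtain C where "\<And>n. norm (G n) \<le> C" using jost_solution_bounded[OF sm z G] by blast
    moreover have "G k = vector [1, 0] - integral_sum G k" for k
      using G unfolding is_jost_solution_def integral_sum_def by blast
    ultimately show ?thesis using bounded_solution_unique F by blast
  qed
  ultimately show ?thesis unfolding jost_solution_def by (rule theI)
qed

section \<open>The Szego recursion and its invariant form\<close>

lemma zeta_mult_Suc: "zeta z k * zeta z (Suc k) = z"
  by (simp add: zeta_def)

text \<open>The term n = k + 1 is split off from each series; the rest is the series of the equation
  at k + 1, up to a factor in the second component. Multiplying that component by
  \<open>zeta z k\<close> turns the remaining \<open>zeta z (Suc k)\<close> into z.\<close>

lemma jost_solution_recurrence:
  assumes F: "is_jost_solution \<alpha> z F"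
  shows "F k $ 1 = F (Suc k) $ 1 - \<alpha> (Suc k) * (zeta z (Suc k) * F (Suc k) $ 2)"
    and "zeta z k * F k $ 2
      = z * (zeta z (Suc k) * F (Suc k) $ 2 - cnj (\<alpha> (Suc k)) * F (Suc k) $ 1)"
proof -
  note c = jost_solution_components[OF F]
  show "F k $ 1 = F (Suc k) $ 1 - \<alpha> (Suc k) * (zeta z (Suc k) * F (Suc k) $ 2)"
    unfolding c(2)[of k] c(2)[of "Suc k"] using suminf_split_head[OF c(1)[of k]]
    by (simp add: mult.assoc)
  let ?a = "\<lambda>m. cnj (\<alpha> (m + k + 1)) * F (m + k + 1) $ 1"
  have "(\<Sum>m. z ^ m * cnj (\<alpha> (m + k + 1)) * zeta z (k + 1) * F (m + k + 1) $ 1)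
      = zeta z (Suc k) * cnj (\<alpha> (Suc k)) * F (Suc k) $ 1
        + (\<Sum>m. z ^ Suc m * cnj (\<alpha> (Suc m + k + 1)) * zeta z (k + 1) * F (Suc m + k + 1) $ 1)"
    using suminf_split_head[OF c(3)[of k]] by (simp add: algebra_simps)
  \<comment> \<open>Since \<open>zeta z (k + 1) * zeta z (k + 2) = z\<close>, the surplus factor is
    \<open>zeta z (k + 1) ^ 2\<close>; no division is involved, so z = 0 is covered.\<close>
  also have "(\<lambda>m. z ^ Suc m * cnj (\<alpha> (Suc m + k + 1)) * zeta z (k + 1) * F (Suc m + k + 1) $ 1)
      = (\<lambda>m. zeta z (k + 1) ^ 2 *
          (z ^ m * cnj (\<alpha> (m + Suc k + 1)) * zeta z (Suc k + 1) * F (m + Suc k + 1) $ 1))"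
    using zeta_mult_Suc[of z "Suc k"] by (auto simp: power2_eq_square fun_eq_iff algebra_simps)
  also have "suminf \<dots> = zeta z (k + 1) ^ 2 * (- F (Suc k) $ 2)"
    unfolding c(4)[of "Suc k"] by (subst suminf_mult[OF c(3)]) simp
  finally have "F k $ 2 = zeta z (Suc k) * (zeta z (Suc k) * F (Suc k) $ 2 - cnj (\<alpha> (Suc k)) * F (Suc k) $ 1)"
    unfolding c(4)[of k] by (simp add: power2_eq_square algebra_simps)
  then show "zeta z k * F k $ 2
      = z * (zeta z (Suc k) * F (Suc k) $ 2 - cnj (\<alpha> (Suc k)) * F (Suc k) $ 1)"
    using zeta_mult_Suc[of z k] by (metis mult.assoc)
qed

text \<open>The cross terms of the two squares are complex conjugates of each other and cancel. In
  other words, the step matrix is a multiple of one that preserves the form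
  \<open>|a|^2 - |x|^2\<close>.\<close>

lemma szego_step_identity:
  fixes a x \<alpha> :: complex
  shows "(cmod (a - \<alpha> * x))\<^sup>2 - (cmod (x - cnj \<alpha> * a))\<^sup>2
    = (1 - (cmod \<alpha>)\<^sup>2) * ((cmod a)\<^sup>2 - (cmod x)\<^sup>2)"
proof -
  have "complex_of_real ((cmod (a - \<alpha> * x))\<^sup>2 - (cmod (x - cnj \<alpha> * a))\<^sup>2)
    = complex_of_real ((1 - (cmod \<alpha>)\<^sup>2) * ((cmod a)\<^sup>2 - (cmod x)\<^sup>2))"
    unfolding of_real_diff of_real_mult of_real_1 complex_norm_square by (simp add: algebra_simps)
  then show ?thesis using of_real_eq_iff by blast
qed

text \<open>The identity bounds the new gap below in terms of the old \<open>a\<close>. To measure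
  it against the new first component, \<open>|a - \<alpha> x| \<le> 2 |a|\<close> is used, which
  costs the factor 1/4. The gap is positive, so that component cannot vanish.\<close>

lemma szego_step_contraction:
  fixes a x \<alpha> :: complex
  assumes a: "a \<noteq> 0" and \<alpha>: "cmod \<alpha> < 1" and \<epsilon>: "0 < \<epsilon>" "\<epsilon> \<le> 1"
    and le: "(cmod x)\<^sup>2 \<le> (1 - \<epsilon>) * (cmod a)\<^sup>2"
  shows "a - \<alpha> * x \<noteq> 0"
    and "(cmod (x - cnj \<alpha> * a))\<^sup>2 \<le> (1 - (1 - (cmod \<alpha>)\<^sup>2) * \<epsilon> / 4) * (cmod (a - \<alpha> * x))\<^sup>2"
proof -
  have c: "0 < 1 - (cmod \<alpha>)\<^sup>2" using \<alpha> by (simp add: power_less_one_iff)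
  have "\<epsilon> * (cmod a)\<^sup>2 \<le> (cmod a)\<^sup>2 - (cmod x)\<^sup>2" using le by (simp add: algebra_simps)
  then have 1: "(1 - (cmod \<alpha>)\<^sup>2) * (\<epsilon> * (cmod a)\<^sup>2)
      \<le> (cmod (a - \<alpha> * x))\<^sup>2 - (cmod (x - cnj \<alpha> * a))\<^sup>2"
    unfolding szego_step_identity using c by (intro mult_left_mono) auto
  moreover have "0 < (1 - (cmod \<alpha>)\<^sup>2) * (\<epsilon> * (cmod a)\<^sup>2)" using c \<epsilon> a by simp
  ultimately show "a - \<alpha> * x \<noteq> 0" by (smt (verit) norm_zero zero_le_power2 power_zero_numeral)
  have "(cmod x)\<^sup>2 \<le> (cmod a)\<^sup>2"
    using order_trans[OF le mult_right_mono[of "1 - \<epsilon>" 1 "(cmod a)\<^sup>2"]] \<epsilon> by simp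
  then have "cmod x \<le> cmod a" by (simp add: power2_le_iff_abs_le)
  then have "cmod \<alpha> * cmod x \<le> 1 * cmod a" using \<alpha> by (intro mult_mono) auto
  then have "cmod (a - \<alpha> * x) \<le> 2 * cmod a"
    using norm_triangle_ineq4[of a "\<alpha> * x"] by (simp add: norm_mult)
  then have "(cmod (a - \<alpha> * x))\<^sup>2 \<le> (2 * cmod a)\<^sup>2" by (intro power_mono) auto
  then have "(1 - (cmod \<alpha>)\<^sup>2) * \<epsilon> / 4 * (cmod (a - \<alpha> * x))\<^sup>2
      \<le> (1 - (cmod \<alpha>)\<^sup>2) * \<epsilon> / 4 * (2 * cmod a)\<^sup>2"
    using c \<epsilon> by (intro mult_left_mono) auto
  also have "\<dots> = (1 - (cmod \<alpha>)\<^sup>2) * (\<epsilon> * (cmod a)\<^sup>2)" by (simp add: power2_eq_square)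
  finally show "(cmod (x - cnj \<alpha> * a))\<^sup>2
      \<le> (1 - (1 - (cmod \<alpha>)\<^sup>2) * \<epsilon> / 4) * (cmod (a - \<alpha> * x))\<^sup>2"
    using 1 by (simp add: algebra_simps)
qed

section \<open>Propagation of the domination from a large index down to 0\<close>

lemma jost_solution_tail:
  assumes sm: "summable (\<lambda>n. 2 ^ (n + 1) * cmod (\<alpha> n))"
  obtains K where "\<And>z. cmod z \<le> 2 \<Longrightarrow> jost_solution \<alpha> z K $ 1 \<noteq> 0 \<and>
    (cmod (zeta z K * jost_solution \<alpha> z K $ 2))\<^sup>2 \<le> (1 - 1/2) * (cmod (jost_solution \<alpha> z K $ 1))\<^sup>2"
proof -
  \<comment> \<open>The bounds \<open>c\<close> are the same for all z, so the instance z = 0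
    supplies a \<open>K\<close> before z is fixed.\<close>
  interpret volterra_kernel "\<lambda>k n. (*v) (jost_kernel \<alpha> 0 k n)" "\<lambda>n. 2 ^ (n + 1) * cmod (\<alpha> n)"
    by (rule jost_volterra_kernel[OF sm]) simp
  \<comment> \<open>A tail of 1/8 puts \<open>F K\<close> within (1/8)/(1 - 1/8) = 1/7 of (1, 0).
    Then the first component is at least 6/7 and the second, times \<open>zeta\<close>, at most 2/7:
    the squared ratio is at most 1/9.\<close>
  obtain K where K: "\<And>k. K \<le> k \<Longrightarrow> (\<Sum>m. 2 ^ (m + k + 1 + 1) * cmod (\<alpha> (m + k + 1))) \<le> 1/8"
    using tail_small[of "1/8"] by auto
  show ?thesis
  proof (rule that[of K])
    fix z :: complex assume z: "cmod z \<le> 2"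
    define F where "F = jost_solution \<alpha> z"
    interpret z: volterra_kernel "\<lambda>k n. (*v) (jost_kernel \<alpha> z k n)" "\<lambda>n. 2 ^ (n + 1) * cmod (\<alpha> n)"
      by (rule jost_volterra_kernel[OF sm z])
    have F: "is_jost_solution \<alpha> z F"
      unfolding F_def by (rule jost_solution_is_solution[OF sm z])
    obtain B where B: "\<And>n. norm (F n) \<le> B" using jost_solution_bounded[OF sm z F] by blast
    define u :: "complex^2" where "u = vector [1, 0]"
    have eq: "F k = u - z.integral_sum F k" for k
      using F unfolding is_jost_solution_def z.integral_sum_def u_def by blast
    have "norm u \<le> 1" using norm_complex2_le[of u] by (simp add: u_def)
    moreover have "norm (F K - u) \<le> 1/8 * (norm u / (1 - 1/8))"
      by (rule z.bounded_solution_near_source[OF eq B K]) auto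
    ultimately have d: "norm (F K - u) \<le> 1/7" by simp
    have 1: "cmod (F K $ 1 - 1) \<le> 1/7" and 2: "cmod (F K $ 2) \<le> 1/7"
      using order_trans[OF Finite_Cartesian_Product.norm_nth_le d, of 1] order_trans[OF Finite_Cartesian_Product.norm_nth_le d, of 2]
      by (simp_all add: u_def)
    have a: "6/7 \<le> cmod (F K $ 1)"
      using 1 norm_triangle_ineq2[of 1 "1 - F K $ 1"] by (simp add: norm_minus_commute)
    have "cmod (zeta z K) * cmod (F K $ 2) \<le> 2 * (1/7)"
      using z 2 by (intro mult_mono) (auto simp: zeta_def)
    then have x: "(cmod (zeta z K * F K $ 2))\<^sup>2 \<le> (2/7)\<^sup>2"
      unfolding norm_mult by (intro power_mono) auto
    have "(6/7)\<^sup>2 \<le> (cmod (F K $ 1))\<^sup>2" using a by (intro power_mono) auto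
    with x have "(cmod (zeta z K * F K $ 2))\<^sup>2 \<le> (1 - 1/2) * (cmod (F K $ 1))\<^sup>2"
      by (simp add: power2_eq_square)
    then show "jost_solution \<alpha> z K $ 1 \<noteq> 0 \<and>
      (cmod (zeta z K * jost_solution \<alpha> z K $ 2))\<^sup>2 \<le> (1 - 1/2) * (cmod (jost_solution \<alpha> z K $ 1))\<^sup>2"
      using a unfolding F_def[symmetric] by auto
  qed
qed

lemma jost_solution_second_dominated:
  assumes ver: "verblunsky \<alpha>" and sm: "summable (\<lambda>n. 2 ^ (n + 1) * cmod (\<alpha> n))"
  obtains \<delta> where "0 < \<delta>"
    "\<And>z. cmod z < 1 + \<delta> \<Longrightarrow> cmod (jost_solution \<alpha> z 0 $ 2) < cmod (jost_solution \<alpha> z 0 $ 1)"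
proof -
  define a where "a z k = jost_solution \<alpha> z k $ 1" for z k
  define x where "x z k = zeta z k * jost_solution \<alpha> z k $ 2" for z k
  have rec: "a z k = a z (Suc k) - \<alpha> (Suc k) * x z (Suc k)"
    "x z k = z * (x z (Suc k) - cnj (\<alpha> (Suc k)) * a z (Suc k))" if "cmod z \<le> 2" for z k
    using jost_solution_recurrence[OF jost_solution_is_solution[OF sm that]]
    unfolding a_def x_def by blast+
  \<comment> \<open>\<open>\<delta>\<close> is the room outside the unit circle and
    \<open>\<epsilon>\<close> the gap of the squared ratio below 1. Both may shrink in each step,
    but only finitely many steps are made.\<close>
  define P where "P k \<delta> \<epsilon> \<longleftrightarrow> 0 < \<delta> \<and> \<delta> \<le> 1 \<and> 0 < \<epsilon> \<and> \<epsilon> \<le> 1 \<and>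
    (\<forall>z. cmod z < 1 + \<delta> \<longrightarrow> a z k \<noteq> 0 \<and> (cmod (x z k))\<^sup>2 \<le> (1 - \<epsilon>) * (cmod (a z k))\<^sup>2)"
    for k and \<delta> \<epsilon> :: real
  have step: "\<exists>\<delta> \<epsilon>. P k \<delta> \<epsilon>" if "P (Suc k) \<delta> \<epsilon>" for k \<delta> \<epsilon>
  proof -
    define \<epsilon>' where "\<epsilon>' = (1 - (cmod (\<alpha> (Suc k)))\<^sup>2) * \<epsilon> / 4"
    \<comment> \<open>With \<open>4 * \<delta>' \<le> \<epsilon>'\<close>, the growth
      \<open>(1 + \<delta>')^2 \<le> 1 + 3 * \<delta>'\<close> caused by z uses up at most three
      quarters of the gap \<open>\<epsilon>'\<close>.\<close>
    define \<delta>' where "\<delta>' = min \<delta> (\<epsilon>' / 4)"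
    have \<alpha>: "cmod (\<alpha> (Suc k)) < 1" using ver by (simp add: verblunsky_def)
    have "0 < 1 - (cmod (\<alpha> (Suc k)))\<^sup>2" "1 - (cmod (\<alpha> (Suc k)))\<^sup>2 \<le> 1"
      using \<alpha> by (auto simp: power_less_one_iff)
    then have \<epsilon>': "0 < \<epsilon>'" "\<epsilon>' \<le> 1"
      using that mult_mono[of "1 - (cmod (\<alpha> (Suc k)))\<^sup>2" 1 \<epsilon> 1] by (auto simp: \<epsilon>'_def P_def)
    have \<delta>': "0 < \<delta>'" "\<delta>' \<le> \<delta>" "\<delta>' \<le> 1" "4 * \<delta>' \<le> \<epsilon>'"
      using that \<epsilon>' by (auto simp: \<delta>'_def P_def)
    have "P k \<delta>' (\<epsilon>' / 4)"
      unfolding P_def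
    proof (intro conjI allI impI)
      fix z assume z: "cmod z < 1 + \<delta>'"
      note r = rec[of z k]
      define y where "y = x z (Suc k) - cnj (\<alpha> (Suc k)) * a z (Suc k)"
      have z2: "cmod z \<le> 2" using z \<delta>' by linarith
      have "a z (Suc k) \<noteq> 0" "(cmod (x z (Suc k)))\<^sup>2 \<le> (1 - \<epsilon>) * (cmod (a z (Suc k)))\<^sup>2"
        "0 < \<epsilon>" "\<epsilon> \<le> 1"
        using that z \<delta>' unfolding P_def by auto
      note s = szego_step_contraction[OF this(1) \<alpha> this(3,4,2)]
      show "a z k \<noteq> 0" using s(1) r(1)[OF z2] by simp
      have y: "(cmod y)\<^sup>2 \<le> (1 - \<epsilon>') * (cmod (a z k))\<^sup>2"
        using s(2) r(1)[OF z2] unfolding y_def \<epsilon>'_def by simp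
      have "(cmod z)\<^sup>2 \<le> (1 + \<delta>')\<^sup>2" using z by (intro power_mono) auto
      also have "\<dots> \<le> 1 + 3 * \<delta>'"
        using mult_left_mono[of \<delta>' 1 \<delta>'] \<delta>' by (simp add: power2_eq_square algebra_simps)
      finally have z3: "(cmod z)\<^sup>2 \<le> 1 + 3 * \<delta>'" .
      have "(cmod (x z k))\<^sup>2 = (cmod z)\<^sup>2 * (cmod y)\<^sup>2"
        unfolding r(2)[OF z2] y_def by (simp add: norm_mult power_mult_distrib)
      also have "\<dots> \<le> (1 + 3 * \<delta>') * ((1 - \<epsilon>') * (cmod (a z k))\<^sup>2)"
        using z3 y \<delta>' by (intro mult_mono) auto
      also have "\<dots> = ((1 + 3 * \<delta>') * (1 - \<epsilon>')) * (cmod (a z k))\<^sup>2" by simp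
      also have "\<dots> \<le> (1 - \<epsilon>' / 4) * (cmod (a z k))\<^sup>2"
      proof (rule mult_right_mono)
        have "0 \<le> \<delta>' * \<epsilon>'" using \<delta>' \<epsilon>' by simp
        moreover have "(1 + 3 * \<delta>') * (1 - \<epsilon>') = 1 + 3 * \<delta>' - \<epsilon>' - 3 * (\<delta>' * \<epsilon>')"
          by (simp add: algebra_simps)
        ultimately show "(1 + 3 * \<delta>') * (1 - \<epsilon>') \<le> 1 - \<epsilon>' / 4"
          using \<delta>' by linarith
      qed simp
      finally show "(cmod (x z k))\<^sup>2 \<le> (1 - \<epsilon>' / 4) * (cmod (a z k))\<^sup>2" .
    qed (use \<delta>' \<epsilon>' in auto)
    then show ?thesis by blast
  qed
  obtain K where "\<And>z. cmod z \<le> 2 \<Longrightarrow> a z K \<noteq> 0 \<and> (cmod (x z K))\<^sup>2 \<le> (1 - 1/2) * (cmod (a z K))\<^sup>2"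
    using jost_solution_tail[OF sm] unfolding a_def x_def by blast
  \<comment> \<open>\<open>\<delta> = 1\<close> matches the disk of radius 2 on which the tail
    estimate holds.\<close>
  then have "P K 1 (1/2)" unfolding P_def by auto
  then have "\<exists>\<delta> \<epsilon>. P (K - j) \<delta> \<epsilon>" for j
  proof (induction j)
    case (Suc j)
    then show ?case
    proof (cases "j < K")
      case True
      then have "K - j = Suc (K - Suc j)" by simp
      then show ?thesis using Suc step by metis
    qed simp
  qed auto
  from this[of K] obtain \<delta> \<epsilon> where P: "P 0 \<delta> \<epsilon>" by auto
  show ?thesis
  proof (rule that[of \<delta>])
    fix z assume "cmod z < 1 + \<delta>"
    then have a: "a z 0 \<noteq> 0" and le: "(cmod (x z 0))\<^sup>2 \<le> (1 - \<epsilon>) * (cmod (a z 0))\<^sup>2"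
      using P unfolding P_def by auto
    have "(1 - \<epsilon>) * (cmod (a z 0))\<^sup>2 < 1 * (cmod (a z 0))\<^sup>2"
      using P a unfolding P_def by (intro mult_strict_right_mono) auto
    with le have "(cmod (x z 0))\<^sup>2 < (cmod (a z 0))\<^sup>2" by simp
    then have "cmod (x z 0) < cmod (a z 0)" by (rule power_less_imp_less_base) simp
    \<comment> \<open>Index 0 is even, so \<open>zeta z 0 = 1\<close> and \<open>x z 0\<close> is
      the second component itself.\<close>
    then show "cmod (jost_solution \<alpha> z 0 $ 2) < cmod (jost_solution \<alpha> z 0 $ 1)"
      by (simp add: a_def x_def zeta_def)
  qed (use P in \<open>auto simp: P_def\<close>)
qed

section \<open>The normalising constant and the conclusion\<close>

text \<open>\<open>convergent_prod\<close> excludes products that tend to 0 with nonzero factors, so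
  convergence is the point. It follows from \<open>1 - rho \<le> |\<alpha>|\<close> and the
  summability of \<alpha>.\<close>

lemma prodinf_inverse_rho_nonzero:
  assumes ver: "verblunsky \<alpha>" and sm: "summable (\<lambda>n. cmod (\<alpha> n))"
  shows "(\<Prod>j. inverse (rho \<alpha> (Suc j))) \<noteq> 0"
proof -
  have le: "norm (rho \<alpha> (Suc j) - 1) \<le> cmod (\<alpha> (Suc j))" for j
  proof -
    have c: "cmod (\<alpha> (Suc j)) < 1" using ver by (simp add: verblunsky_def)
    \<comment> \<open>For 0 \<le> t \<le> 1, \<open>(1 - t)^2 \<le> (1 - t) * (1 + t)\<close>;
      taking roots bounds \<open>rho\<close> below by 1 - t.\<close>
    have "(1 - cmod (\<alpha> (Suc j)))\<^sup>2 \<le> 1 - (cmod (\<alpha> (Suc j)))\<^sup>2"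
      using c mult_left_mono[of "cmod (\<alpha> (Suc j))" 1 "cmod (\<alpha> (Suc j))"]
      by (simp add: power2_eq_square algebra_simps)
    then have "1 - cmod (\<alpha> (Suc j)) \<le> rho \<alpha> (Suc j)"
      unfolding rho_def by (rule real_le_rsqrt)
    moreover have "rho \<alpha> (Suc j) \<le> 1" unfolding rho_def by simp
    ultimately show ?thesis by simp
  qed
  have "summable (\<lambda>j. norm (rho \<alpha> (Suc j) - 1))"
    by (rule summable_comparison_test'[of "\<lambda>j. cmod (\<alpha> (Suc j))" 0])
      (use le sm summable_Suc_iff[of "\<lambda>n. cmod (\<alpha> n)"] in auto)
  then have "convergent_prod (\<lambda>j. rho \<alpha> (Suc j))"
    by (intro abs_convergent_prod_imp_convergent_prod) (simp add: abs_convergent_prod_conv_summable)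
  then have "convergent_prod (\<lambda>j. inverse (rho \<alpha> (Suc j)))"
    by (rule convergent_prod_inverse)
  then show ?thesis
    by (rule prodinf_nonzero) (use rho_pos[OF ver] in \<open>simp add: less_imp_neq[symmetric]\<close>)
qed

theorem theorem1p1:
  fixes \<gamma> \<eta> Q :: real and \<alpha> :: "nat \<Rightarrow> complex" and U :: "(nat \<Rightarrow> complex) \<Rightarrow> nat \<Rightarrow> complex"
  assumes "\<gamma> > 1" and "\<eta> > 0" and "Q > 1"
    and "\<alpha> \<in> B0 \<gamma> \<eta> Q"
    and "U = cmv_operator \<alpha>"
  shows "\<exists>\<delta>>0. resonances U \<inter> {z. cmod z < 1 + \<delta>} = {}"
proof -
  have ver: "verblunsky \<alpha>" and dec: "super_exp_decay \<gamma> \<eta> \<alpha>"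
    using assms(4) by (auto simp: B0_def)
  have sm: "summable (\<lambda>n. 2 ^ (n + 1) * cmod (\<alpha> n))"
    by (rule summable_super_exp_decay[OF dec assms(1)])
  obtain \<delta> where \<delta>: "0 < \<delta>" "\<And>z. cmod z < 1 + \<delta> \<Longrightarrow>
      cmod (jost_solution \<alpha> z 0 $ 2) < cmod (jost_solution \<alpha> z 0 $ 1)"
    using jost_solution_second_dominated[OF ver sm] by blast
  have "1 * cmod (\<alpha> n) \<le> 2 ^ (n + 1) * cmod (\<alpha> n)" for n
    by (intro mult_right_mono one_le_power) auto
  then have "summable (\<lambda>n. cmod (\<alpha> n))"
    by (intro summable_comparison_test'[OF sm, of 0]) simp
  then have "(\<Prod>j. inverse (rho \<alpha> (Suc j))) \<noteq> 0"
    by (rule prodinf_inverse_rho_nonzero[OF ver])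
  then have "jost_function \<alpha> z \<noteq> 0" if "cmod z < 1 + \<delta>" for z
    using \<delta>(2)[OF that] unfolding jost_function_def by auto
  \<comment> \<open>\<open>resonances U\<close> ranges over all coefficients that produce
    \<open>U\<close>; injectivity of the CMV map reduces it to the zeros for this \<alpha>.\<close>
  then show ?thesis
    using \<delta>(1) unfolding assms(5) resonances_cmv_operator[OF ver dec assms(1,2)] by blast
qed

end
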